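(* Let $S$ be a nonempty admissible set and $m=\max(S)$. If the peak polynomial $p_S$ has no complex zero whose real part is greater than $m$, then $(\Delta^j p_S)(m)>0$ for every $1\le j\le m-1$.
   Context: For a permutation $\pi=\pi_1\cdots\pi_n\in\mathfrak S_n$, an index $1<i<n$ is a peak if $\pi_{i-1}<\pi_i>\pi_{i+1}$; $P(\pi)$ is the set of peaks of $\pi$, and $\mathcal P_S(n)=\{\pi\in\mathfrak S_n: P(\pi)=S\}$. A finite set $S$ of positive integers is admissible if $\mathcal P_S(n)\neq\emptyset$ for some $n$; equivalently $1\notin S$ and $S$ contains no two consecutive integers. Known fact (Billey–Burdzy–Sagan): for a nonempty admissible $S$ with $m=\max(S)$ there is a unique polynomial $p_S(x)$, of degree $m-1$ and integer-valued on integers, such that $|\mathcal P_S(n)|=p_S(n)2^{n-|S|-1}$ for all $n\ge m$; $p_S$ is called the peak polynomial of $S$. $\Delta$ is the forward difference operator, $(\Delta f)(x)=f(x+1)-f(x)$, and $(\Delta^n f)(x)=(\Delta^{n-1}f)(x+1)-(\Delta^{n-1}f)(x)$. *)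

theory Defs
  imports Complex_Main
    "HOL-Combinatorics.Permutations"
    "HOL-Computational_Algebra.Polynomial"
begin

definition peaks :: "nat \<Rightarrow> (nat \<Rightarrow> nat) \<Rightarrow> nat set" where
  "peaks n \<pi> = {i. 1 < i \<and> i < n \<and> \<pi> (i - 1) < \<pi> i \<and> \<pi> i > \<pi> (i + 1)}"

definition perms_with_peak_set :: "nat set \<Rightarrow> nat \<Rightarrow> (nat \<Rightarrow> nat) set" where
  "perms_with_peak_set S n = {\<pi>. \<pi> permutes {1..n} \<and> peaks n \<pi> = S}"

definition admissible :: "nat set \<Rightarrow> bool" where
  "admissible S \<longleftrightarrow> finite S \<and> (\<forall>i\<in>S. 0 < i) \<and> (\<exists>n. perms_with_peak_set S n \<noteq> {})"

(* Meant for nonempty admissible S, where Billey, Burdzy and Sagan show that exactly one p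
   satisfies it. For such S, 2 * card S \<le> Max S, so the exponent is not truncated. *)
definition is_peak_polynomial :: "nat set \<Rightarrow> real poly \<Rightarrow> bool" where
  "is_peak_polynomial S p \<longleftrightarrow>
     degree p = Max S - 1 \<and>
     (\<forall>k::int. poly p (of_int k) \<in> \<int>) \<and>
     (\<forall>n\<ge>Max S. real (card (perms_with_peak_set S n)) = poly p (real n) * 2 ^ (n - card S - 1))"

definition forward_diff :: "(real \<Rightarrow> real) \<Rightarrow> real \<Rightarrow> real" where
  "forward_diff f x = f (x + 1) - f x"

end

theory Submission
  imports Defs "HOL-Computational_Algebra.Fundamental_Theorem_Algebra"
begin

text \<open>
  Every root of \<open>q(x) = p(x + m)\<close> has nonpositive real part, so \<open>q\<close> is a positive
  constant times a product of factors \<open>x + s\<close> with \<open>s \<ge> 0\<close> and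
  \<open>x\<^sup>2 + b x + c\<close> with \<open>b, c \<ge> 0\<close>. Its coefficients are therefore nonnegative, and
  \<open>\<Delta>\<close> maps a polynomial with nonnegative coefficients and positive coefficient of
  \<open>x^d\<close> to one whose coefficients up to \<open>x^(d - 1)\<close> are positive.
\<close>

definition nonneg_poly :: "real poly \<Rightarrow> bool" where
  "nonneg_poly q \<longleftrightarrow> (\<forall>k. 0 \<le> coeff q k)"

lemma nonneg_poly_pCons [simp]: "nonneg_poly (pCons a q) \<longleftrightarrow> 0 \<le> a \<and> nonneg_poly q"
  unfolding nonneg_poly_def by (metis coeff_pCons_0 coeff_pCons_Suc not0_implies_Suc)

lemma nonneg_poly_0 [simp]: "nonneg_poly 0"
  by (simp add: nonneg_poly_def)

lemma nonneg_poly_mult: "nonneg_poly p \<Longrightarrow> nonneg_poly q \<Longrightarrow> nonneg_poly (p * q)"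
  by (auto simp: nonneg_poly_def coeff_mult intro!: sum_nonneg)

text \<open>\<open>forward_diff\<close> acts on functions; this polynomial version exposes the
  coefficients.\<close>

definition poly_diff :: "real poly \<Rightarrow> real poly" where
  "poly_diff q = q \<circ>\<^sub>p [:1, 1:] - q"

lemma poly_poly_diff: "poly (poly_diff q) = (\<lambda>x. poly q (x + 1) - poly q x)"
  by (simp add: poly_diff_def poly_pcompose add.commute fun_eq_iff)

text \<open>The coefficient of x^k in q(x + 1) is the sum over l of (l choose k) times
  \<open>coeff q l\<close>; all terms are nonnegative and the binomial is at least 1 for k \<le> l.
  The induction replaces this sum by the Horner step a + (x + 1) q(x + 1).\<close>

lemma coeff_shift_ge:
  assumes "nonneg_poly q" "k \<le> l"
  shows "coeff q l \<le> coeff (q \<circ>\<^sub>p [:1, 1:]) k"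
  using assms
proof (induction q arbitrary: k l)
  case 0
  then show ?case by simp
next
  case (pCons a q)
  let ?s = "q \<circ>\<^sub>p [:1, 1:]"
  have q: "nonneg_poly q" "0 \<le> a" using pCons.prems by auto
  have ge: "coeff q l \<le> coeff ?s k" if "k \<le> l" for k l
    using pCons.IH[OF q(1) that] .
  have nn: "0 \<le> coeff ?s k" for k
    using ge[of k k] q(1) by (auto simp: nonneg_poly_def intro: order_trans)
  have c: "coeff (pCons a q \<circ>\<^sub>p [:1, 1:]) k
      = (case k of 0 \<Rightarrow> a | Suc i \<Rightarrow> coeff ?s i) + coeff ?s k"
    by (cases k) (auto simp: pcompose_pCons)
  show ?case
  proof (cases l)
    case 0
    then show ?thesis using pCons.prems nn[of k] c by simp
  next
    case (Suc i)
    show ?thesis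
    proof (cases k)
      case 0
      have "coeff q i \<le> coeff ?s 0" by (rule ge) simp
      then show ?thesis using 0 Suc c q(2) by simp
    next
      case k: (Suc k')
      have "coeff q i \<le> coeff ?s k'" using pCons.prems Suc k by (intro ge) simp
      then show ?thesis using k Suc c nn[of k] by simp
    qed
  qed
qed

text \<open>Induction by the product rule \<Delta>(a + x q) = x \<Delta>q + q(x + 1). The inequality
  k < l is strict because subtracting q cancels the term l = k of the shift.\<close>

lemma coeff_poly_diff_ge:
  assumes "nonneg_poly q" "k < l"
  shows "coeff q l \<le> coeff (poly_diff q) k"
  using assms
proof (induction q arbitrary: k l)
  case 0
  then show ?case by (simp add: poly_diff_def)
next
  case (pCons a q)
  have q: "nonneg_poly q" using pCons.prems by auto
  obtain i where l: "l = Suc i" "k \<le> i" using pCons.prems by (cases l) auto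
  have s: "coeff q i \<le> coeff (q \<circ>\<^sub>p [:1, 1:]) k"
    by (rule coeff_shift_ge[OF q l(2)])
  have "0 \<le> coeff (poly_diff q) k'" for k'
    using pCons.IH[OF q, of k' "Suc k'"] q
    by (auto simp: nonneg_poly_def intro: order_trans)
  moreover have "coeff (poly_diff (pCons a q)) k
      = (case k of 0 \<Rightarrow> 0 | Suc i \<Rightarrow> coeff (poly_diff q) i) + coeff (q \<circ>\<^sub>p [:1, 1:]) k"
    by (cases k) (auto simp: poly_diff_def pcompose_pCons)
  ultimately show ?case using s l by (auto split: nat.splits intro: add_increasing)
qed

lemma nonneg_poly_diff: "nonneg_poly q \<Longrightarrow> nonneg_poly (poly_diff q)"
  using coeff_poly_diff_ge lessI unfolding nonneg_poly_def by (meson order_trans)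

text \<open>A single difference makes every coefficient below d positive, so the induction continues
  with d - 1. For j = 0 the claim can fail, as for q = x^d with d > 0.\<close>

lemma coeff_funpow_poly_diff_pos:
  assumes "nonneg_poly q" "0 < coeff q d" "1 \<le> j" "j \<le> d"
  shows "0 < coeff ((poly_diff ^^ j) q) 0"
  using assms
proof (induction j arbitrary: q d)
  case 0
  then show ?case by simp
next
  case (Suc j)
  have pos: "0 < coeff (poly_diff q) k" if "k < d" for k
    using coeff_poly_diff_ge[OF Suc.prems(1) that] Suc.prems(2) by simp
  show ?case
  proof (cases "j = 0")
    case True
    then show ?thesis using pos Suc.prems by simp
  next
    case False
    have "0 < coeff ((poly_diff ^^ j) (poly_diff q)) 0"
      using False Suc.prems
      by (intro Suc.IH[where d = "d - 1"] nonneg_poly_diff pos) auto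
    then show ?thesis by (simp add: funpow_swap1)
  qed
qed

lemma funpow_forward_diff_poly:
  "(forward_diff ^^ j) (poly p) (a + x) = poly ((poly_diff ^^ j) (p \<circ>\<^sub>p [:a, 1:])) x"
proof (induction j arbitrary: x)
  case 0
  then show ?case by (simp add: poly_pcompose)
next
  case (Suc j)
  show ?case
    using Suc.IH[of x] Suc.IH[of "x + 1"]
    by (simp add: forward_diff_def poly_poly_diff add.assoc)
qed

lemma map_poly_complex_of_real_add:
  "map_poly complex_of_real (p + q) = map_poly complex_of_real p + map_poly complex_of_real q"
  by (simp add: poly_eq_iff coeff_map_poly)

lemma map_poly_complex_of_real_mult:
  "map_poly complex_of_real (p * q) = map_poly complex_of_real p * map_poly complex_of_real q"
  by (simp add: poly_eq_iff coeff_map_poly coeff_mult)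

lemma poly_map_poly_complex_of_real:
  "poly (map_poly complex_of_real p) (of_real x) = of_real (poly p x)"
  by (induction p) (simp_all add: map_poly_pCons)

lemma complex_poly_pcompose_shift:
  "poly (map_poly complex_of_real (p \<circ>\<^sub>p [:a, 1:])) z
     = poly (map_poly complex_of_real p) (of_real a + z)"
  by (induction p)
    (simp_all add: pcompose_pCons map_poly_pCons map_poly_complex_of_real_add
      map_poly_complex_of_real_mult algebra_simps del: mult_pCons_left)

text \<open>Strong induction on the degree: a complex root yields a monic real factor of degree 1 or
  2, nonnegative because Re z \<le> 0, and the cofactor inherits the hypotheses.\<close>

lemma nonneg_poly_if_roots_left:
  fixes p :: "real poly"
  assumes "0 < lead_coeff p"
    and "\<And>z. poly (map_poly complex_of_real p) z = 0 \<Longrightarrow> Re z \<le> 0"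
  shows "nonneg_poly p"
  using assms
proof (induction "degree p" arbitrary: p rule: less_induct)
  case less
  let ?C = "map_poly complex_of_real"
  have factor: "nonneg_poly p"
    if "p = f * g" "nonneg_poly f" "lead_coeff f = 1" "0 < degree f" for f g
  proof -
    have "g \<noteq> 0" "f \<noteq> 0" using less.prems(1) that(1) by auto
    then have "degree g < degree p" using that by (simp add: degree_mult_eq)
    moreover have "0 < lead_coeff g" using less.prems(1) that by (simp add: lead_coeff_mult)
    moreover have "Re z \<le> 0" if "poly (?C g) z = 0" for z
      using less.prems(2)[of z] that \<open>p = f * g\<close>
      by (simp add: map_poly_complex_of_real_mult)
    ultimately have "nonneg_poly g" by (rule less.hyps)
    then show ?thesis using that nonneg_poly_mult by simp
  qed
  show ?case
  proof (cases "degree p = 0")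
    case True
    then obtain a where "p = [:a:]" by (rule degree_eq_zeroE)
    then show ?thesis using less.prems(1) by simp
  next
    case False
    then have "\<not> constant (poly (?C p))"
      by (simp add: constant_degree degree_map_poly)
    then obtain z where z: "poly (?C p) z = 0"
      using fundamental_theorem_of_algebra by blast
    have Re: "Re z \<le> 0" using less.prems(2)[OF z] .
    show ?thesis
    proof (cases "Im z = 0")
      case True
      then have "z = of_real (Re z)" by (simp add: complex_eq_iff)
      then have "of_real (poly p (Re z)) = (0 :: complex)"
        using z by (metis poly_map_poly_complex_of_real)
      then have "[:- Re z, 1:] dvd p" by (simp add: poly_eq_0_iff_dvd)
      then obtain g where g: "p = [:- Re z, 1:] * g" by blast
      show ?thesis by (rule factor[OF g]) (use Re in simp_all)
    next
      case False
      \<comment> \<open>This is (x - z)(x - cnj z), expanded with real coefficients.\<close>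
      let ?f = "[:(Re z)\<^sup>2 + (Im z)\<^sup>2, - 2 * Re z, 1:]"
      let ?r = "p mod ?f"
      have fz: "poly (?C ?f) z = 0"
        by (simp add: map_poly_pCons complex_eq_iff power2_eq_square algebra_simps)
      have "?r = 0 \<or> degree ?r < degree ?f" by (rule degree_mod_less) simp
      then have "degree ?r \<le> 1" by auto
      then have r: "?r = [:coeff ?r 0, coeff ?r 1:]" (is "_ = [:?a, ?b:]")
        by (intro poly_eqI) (auto simp: coeff_pCons coeff_eq_0 split: nat.splits)
      have "?C p = ?C (p div ?f * ?f) + ?C ?r"
        unfolding map_poly_complex_of_real_add[symmetric] div_mult_mod_eq ..
      then have "poly (?C ?r) z = 0"
        using z fz by (simp only: map_poly_complex_of_real_mult poly_add poly_mult) simp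
      then have "poly (?C [:?a, ?b:]) z = 0" using r by simp
      \<comment> \<open>The imaginary part of a + b z = 0 is b Im z = 0, which forces b = 0 and then
        a = 0.\<close>
      then have "?a = 0" "?b = 0"
        using False by (auto simp: map_poly_pCons complex_eq_iff)
      then have "?r = 0" using r by simp
      then have "?f dvd p" by (simp only: mod_eq_0_iff_dvd)
      then obtain g where g: "p = ?f * g" by blast
      show ?thesis by (rule factor[OF g]) (use Re in simp_all)
    qed
  qed
qed

text \<open>A negative leading coefficient would make p negative at all large arguments, in
  particular at some natural number beyond N.\<close>

lemma lead_coeff_nonneg_if_nonneg:
  fixes p :: "real poly"
  assumes "\<And>n::nat. N \<le> n \<Longrightarrow> 0 \<le> poly p (real n)"
  shows "0 \<le> lead_coeff p"
proof (rule ccontr)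
  assume "\<not> ?thesis"
  then have neg: "0 < lead_coeff (- p)" by simp
  then obtain B where B: "\<And>x. B \<le> x \<Longrightarrow> lead_coeff (- p) \<le> poly (- p) x"
    using poly_pinfty_gt_lc by blast
  obtain n where "B \<le> real n" using real_arch_simple by blast
  then have "lead_coeff (- p) \<le> poly (- p) (real (max N n))" by (intro B) simp
  then show False using assms[of "max N n"] neg by simp
qed

theorem theorem2p5:
  fixes S :: "nat set" and m :: nat and p :: "real poly"
  assumes "S \<noteq> {}" and "admissible S" and "m = Max S"
    and "is_peak_polynomial S p"
    and "\<not> (\<exists>z::complex. poly (map_poly complex_of_real p) z = 0 \<and> Re z > real m)"
  shows "\<forall>j. 1 \<le> j \<and> j \<le> m - 1 \<longrightarrow> (forward_diff ^^ j) (poly p) (real m) > 0"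
proof (intro allI impI, elim conjE)
  fix j assume j: "1 \<le> j" "j \<le> m - 1"
  let ?q = "p \<circ>\<^sub>p [:real m, 1:]"
  have deg: "degree p = m - 1"
    using assms(3,4) by (simp add: is_peak_polynomial_def)
  then have "p \<noteq> 0" using j by auto
  \<comment> \<open>The sign of p comes from counting: a cardinality is nonnegative and the power of
    2 is positive.\<close>
  have "0 \<le> poly p (real n)" if "m \<le> n" for n
  proof -
    have "real (card (perms_with_peak_set S n)) = poly p (real n) * 2 ^ (n - card S - 1)"
      using assms(3,4) that by (auto simp: is_peak_polynomial_def)
    then have "0 \<le> poly p (real n) * 2 ^ (n - card S - 1)" by (metis of_nat_0_le_iff)
    then show ?thesis
      using mult_right_le_imp_le[of 0 "2 ^ (n - card S - 1)" "poly p (real n)"] by simp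
  qed
  then have "0 \<le> lead_coeff p" by (rule lead_coeff_nonneg_if_nonneg)
  \<comment> \<open>Composing with the monic x + m keeps the leading coefficient, which is nonzero
    since p \<noteq> 0.\<close>
  then have lc: "0 < lead_coeff ?q"
    using \<open>p \<noteq> 0\<close> by (subst lead_coeff_comp) (auto simp: less_le)
  have "nonneg_poly ?q"
  proof (rule nonneg_poly_if_roots_left[OF lc])
    fix z assume "poly (map_poly complex_of_real ?q) z = 0"
    \<comment> \<open>A root z of \<open>?q\<close> is a root m + z of p.\<close>
    then have "\<not> Re (of_real (real m) + z) > real m"
      using assms(5) unfolding complex_poly_pcompose_shift by blast
    then show "Re z \<le> 0" by simp
  qed
  moreover have "degree ?q = m - 1" using deg by (simp add: degree_pcompose)
  \<comment> \<open>The positive coefficient is the leading one, at d = m - 1, which gives exactly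
    the range j \<le> m - 1.\<close>
  ultimately have "0 < coeff ((poly_diff ^^ j) ?q) 0"
    using lc j by (intro coeff_funpow_poly_diff_pos[where d = "m - 1"]) auto
  then show "(forward_diff ^^ j) (poly p) (real m) > 0"
    using funpow_forward_diff_poly[of j p "real m" 0] by (simp add: poly_0_coeff_0)
qed

end
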